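(* Let $\mathcal G$ be a compact, connected, finite metric graph with vertex set $\mathsf V$. Then for an arbitrary Dirichlet vertex set $\emptyset\ne\mathsf V_{\mathrm D}\subset\mathsf V$ the torsional rigidity admits the lower bound \[ T(\mathcal G;\mathsf V_{\mathrm D})\ \ge\ \frac{\operatorname{Inr}(\mathcal G;\mathsf V_{\mathrm D})^3}{3\,(|\mathsf V\setminus\mathsf V_{\mathrm D}|+1)^3}. \]
   Context: A compact, connected, finite metric graph consists of finitely many edges $\mathsf e\simeq[0,\ell_{\mathsf e}]$, $0<\ell_{\mathsf e}<\infty$, glued at their endpoints (vertices) to form a connected space; $d_{\mathcal G}$ is its path metric. The inradius is $\operatorname{Inr}(\mathcal G;\mathsf V_{\mathrm D})=\sup_{x\in\mathcal G}\min_{\mathsf v\in\mathsf V_{\mathrm D}}d_{\mathcal G}(x,\mathsf v)$. The torsion function $v$ with respect to $\mathsf V_{\mathrm D}$ is the unique function that is continuous on $\mathcal G$, in $H^2$ on each edge, with $-v_{\mathsf e}''=1$ on each edge, $v=0$ on $\mathsf V_{\mathrm D}$, and sum of normal derivatives over all incident edges equal to $0$ at each vertex of $\mathsf V\setminus\mathsf V_{\mathrm D}$. The torsional rigidity is $T(\mathcal G;\mathsf V_{\mathrm D})=\int_{\mathcal G}v\,dx$. *)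

theory Defs
  imports "HOL-Analysis.Analysis"
begin

text \<open>
  Every edge \<open>e\<close> is the interval \<open>[0, elen G e]\<close>, glued at parameter \<open>0\<close> to \<open>src G e\<close> and at
  \<open>elen G e\<close> to \<open>tgt G e\<close>. The orientation only fixes the parametrisation. Loops and
  parallel edges are allowed.
\<close>

record ('v, 'e) metric_graph =
  verts :: "'v set"
  edges :: "'e set"
  src :: "'e \<Rightarrow> 'v"
  tgt :: "'e \<Rightarrow> 'v"
  elen :: "'e \<Rightarrow> real"

text \<open>
  A point of the glued space is a vertex or an interior point of an edge; \<open>edge_pt G e\<close> is
  the gluing map, meaningful on \<open>[0, elen G e]\<close> only.
\<close>

datatype ('v, 'e) point = Vertex 'v | Inner 'e real

definition points :: "('v, 'e) metric_graph \<Rightarrow> ('v, 'e) point set" where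
  "points G = Vertex ` verts G \<union> {Inner e t | e t. e \<in> edges G \<and> 0 < t \<and> t < elen G e}"

definition edge_pt :: "('v, 'e) metric_graph \<Rightarrow> 'e \<Rightarrow> real \<Rightarrow> ('v, 'e) point" where
  "edge_pt G e t =
    (if t = 0 then Vertex (src G e) else if t = elen G e then Vertex (tgt G e) else Inner e t)"

text \<open>The quotient topology of the gluing.\<close>

definition graph_topology :: "('v, 'e) metric_graph \<Rightarrow> ('v, 'e) point topology" where
  "graph_topology G = topology (\<lambda>U. U \<subseteq> points G \<and>
    (\<forall>e \<in> edges G. openin (top_of_set {0..elen G e}) {t \<in> {0..elen G e}. edge_pt G e t \<in> U}))"

lemma openin_graph_topology:
  "openin (graph_topology G) U \<longleftrightarrow> U \<subseteq> points G \<and>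
    (\<forall>e \<in> edges G. openin (top_of_set {0..elen G e}) {t \<in> {0..elen G e}. edge_pt G e t \<in> U})"
proof -
  let ?P = "\<lambda>U. U \<subseteq> points G \<and>
    (\<forall>e \<in> edges G. openin (top_of_set {0..elen G e}) {t \<in> {0..elen G e}. edge_pt G e t \<in> U})"
  have "?P (S \<inter> T)" if "?P S" "?P T" for S T
  proof -
    have "{t \<in> {0..elen G e}. edge_pt G e t \<in> S \<inter> T} =
      {t \<in> {0..elen G e}. edge_pt G e t \<in> S} \<inter> {t \<in> {0..elen G e}. edge_pt G e t \<in> T}" for e
      by blast
    then show ?thesis using that by (auto intro: openin_Int)
  qed
  moreover have "?P (\<Union>K)" if "\<forall>S \<in> K. ?P S" for K
  proof -
    have "{t \<in> {0..elen G e}. edge_pt G e t \<in> \<Union>K} =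
      (\<Union>S \<in> K. {t \<in> {0..elen G e}. edge_pt G e t \<in> S})" for e
      by blast
    then show ?thesis using that by (auto intro!: openin_Union)
  qed
  ultimately have "istopology ?P" unfolding istopology_def by blast
  then show ?thesis by (simp add: graph_topology_def topology_inverse')
qed

definition compact_connected_metric_graph :: "('v, 'e) metric_graph \<Rightarrow> bool" where
  "compact_connected_metric_graph G \<longleftrightarrow>
    finite (verts G) \<and> finite (edges G) \<and>
    (\<forall>e \<in> edges G. src G e \<in> verts G \<and> tgt G e \<in> verts G \<and> 0 < elen G e) \<and>
    connected_space (graph_topology G)"

text \<open>
  \<open>graph_walk G x r y\<close>: there is a path of length \<open>r\<close> from \<open>x\<close> to \<open>y\<close>, concatenated from
  finitely many segments of edges.
\<close>

inductive graph_walk ::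
  "('v, 'e) metric_graph \<Rightarrow> ('v, 'e) point \<Rightarrow> real \<Rightarrow> ('v, 'e) point \<Rightarrow> bool"
  for G where
  refl: "x \<in> points G \<Longrightarrow> graph_walk G x 0 x"
| step: "\<lbrakk>e \<in> edges G; s \<in> {0..elen G e}; t \<in> {0..elen G e}; graph_walk G (edge_pt G e t) r y\<rbrakk>
    \<Longrightarrow> graph_walk G (edge_pt G e s) (\<bar>s - t\<bar> + r) y"

definition graph_dist ::
  "('v, 'e) metric_graph \<Rightarrow> ('v, 'e) point \<Rightarrow> ('v, 'e) point \<Rightarrow> real" where
  "graph_dist G x y = Inf {r. graph_walk G x r y}"

definition inradius :: "('v, 'e) metric_graph \<Rightarrow> 'v set \<Rightarrow> real" where
  "inradius G D = (SUP x \<in> points G. MIN w \<in> D. graph_dist G x (Vertex w))"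

definition L2_on :: "real set \<Rightarrow> (real \<Rightarrow> real) \<Rightarrow> bool" where
  "L2_on I f \<longleftrightarrow>
    f \<in> borel_measurable (lebesgue_on I) \<and> integrable (lebesgue_on I) (\<lambda>t. (f t)\<^sup>2)"

text \<open>
  \<open>f \<in> H\<^sup>1(0, l)\<close> with derivative \<open>g\<close>: \<open>f\<close> is absolutely continuous on \<open>[0, l]\<close>, being an
  indefinite Lebesgue integral of the square integrable function \<open>g\<close>. As usual in one
  dimension, elements of the Sobolev spaces are identified with their continuous
  representatives, so \<open>f\<close> is pinned down pointwise and \<open>g\<close> almost everywhere.
\<close>

definition has_H1_deriv :: "real \<Rightarrow> (real \<Rightarrow> real) \<Rightarrow> (real \<Rightarrow> real) \<Rightarrow> bool" where
  "has_H1_deriv l f g \<longleftrightarrow> L2_on {0..l} f \<and> L2_on {0..l} g \<and>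
    (\<forall>t \<in> {0..l}. f t = f 0 + integral\<^sup>L (lebesgue_on {0..t}) g)"

text \<open>\<open>f \<in> H\<^sup>2(0, l)\<close> with \<open>f'' = h\<close> almost everywhere.\<close>

definition has_H2_second_deriv :: "real \<Rightarrow> (real \<Rightarrow> real) \<Rightarrow> (real \<Rightarrow> real) \<Rightarrow> bool" where
  "has_H2_second_deriv l f h \<longleftrightarrow> (\<exists>g. has_H1_deriv l f g \<and> has_H1_deriv l g h)"

abbreviation on_edge ::
  "('v, 'e) metric_graph \<Rightarrow> (('v, 'e) point \<Rightarrow> real) \<Rightarrow> 'e \<Rightarrow> real \<Rightarrow> real" where
  "on_edge G u e \<equiv> \<lambda>t. u (edge_pt G e t)"

text \<open>
  Sum of the derivatives at \<open>w\<close>, taken from the vertex into the edge, over all edge ends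
  at \<open>w\<close>; a loop contributes both of its ends.
\<close>

definition normal_deriv_sum ::
  "('v, 'e) metric_graph \<Rightarrow> (('v, 'e) point \<Rightarrow> real) \<Rightarrow> 'v \<Rightarrow> real" where
  "normal_deriv_sum G u w =
    (\<Sum>e \<in> {e \<in> edges G. src G e = w}.
      vector_derivative (on_edge G u e) (at 0 within {0..elen G e})) +
    (\<Sum>e \<in> {e \<in> edges G. tgt G e = w}.
      - vector_derivative (on_edge G u e) (at (elen G e) within {0..elen G e}))"

definition is_torsion_function ::
  "('v, 'e) metric_graph \<Rightarrow> 'v set \<Rightarrow> (('v, 'e) point \<Rightarrow> real) \<Rightarrow> bool" where
  "is_torsion_function G D u \<longleftrightarrow>
    continuous_map (graph_topology G) euclideanreal u \<and>
    (\<forall>e \<in> edges G. \<exists>h. has_H2_second_deriv (elen G e) (on_edge G u e) h \<and>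
      (AE t in lebesgue_on {0..elen G e}. - h t = 1)) \<and>
    (\<forall>w \<in> D. u (Vertex w) = 0) \<and>
    (\<forall>w \<in> verts G - D. normal_deriv_sum G u w = 0)"

text \<open>
  \<open>extensional\<close> fixes the irrelevant values outside \<open>points G\<close>; without it the
  description could never be unique.
\<close>

definition torsion_function ::
  "('v, 'e) metric_graph \<Rightarrow> 'v set \<Rightarrow> ('v, 'e) point \<Rightarrow> real" where
  "torsion_function G D = (THE u. u \<in> extensional (points G) \<and> is_torsion_function G D u)"

definition torsional_rigidity :: "('v, 'e) metric_graph \<Rightarrow> 'v set \<Rightarrow> real" where
  "torsional_rigidity G D =
    (\<Sum>e \<in> edges G.
      integral\<^sup>L (lebesgue_on {0..elen G e}) (on_edge G (torsion_function G D) e))"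

end

theory Submission
  imports Defs
begin

text \<open>
  On every edge the torsion function is a parabola determined by its vertex values, which solve
  an invertible discrete Dirichlet problem with Kirchhoff conditions. Completing the square gives
  \<open>T \<ge> J(g)\<close>, where \<open>J(g)\<close> sums
  \<open>l (g(a) + g(b)) + l\<^sup>3/12 - (g(a) - g(b))\<^sup>2/l\<close> over the edges \<open>ab\<close> of length \<open>l\<close>, for all
  vertex functions \<open>g\<close> vanishing on \<open>D\<close>.

  Let \<open>N\<close> be the number of other vertices and \<open>L = Inr/(N + 1)\<close>. One of the \<open>N + 1\<close> open
  intervals \<open>(kL, (k + 1)L)\<close> contains no distance from a vertex to \<open>D\<close>. If some vertex lies
  beyond it, take \<open>g = 0\<close> below the gap and \<open>g = L\<^sup>2/2\<close> above: by connectedness some edge crosses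
  the gap, it has length at least \<open>L\<close>, and it contributes at least \<open>L\<^sup>3/3\<close> to \<open>J(g)\<close>.
  Otherwise all vertices are within \<open>NL\<close> of \<open>D\<close>, so some edge has length at least \<open>2L\<close>, and
  \<open>g = 0\<close> suffices.
\<close>

section \<open>Underdetermined linear systems\<close>

text \<open>Gaussian elimination: if equation \<open>r\<close> has a nonzero pivot, solving it for
  the pivot unknown removes one equation and one unknown, so the count hypothesis survives the
  induction.\<close>

lemma underdetermined_system_nontrivial_solution:
  fixes A :: "'a \<Rightarrow> 'b \<Rightarrow> 'c::field"
  assumes "finite R" "finite S" "card R < card S"
  shows "\<exists>x. (\<exists>j\<in>S. x j \<noteq> 0) \<and> (\<forall>i\<in>R. (\<Sum>j\<in>S. A i j * x j) = 0)"
  using assms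
proof (induction R arbitrary: S A rule: finite_induct)
  case empty
  then have "S \<noteq> {}" by auto
  then show ?case by (intro exI[of _ "\<lambda>_. 1"]) auto
next
  case (insert r R)
  show ?case
  proof (cases "\<forall>j\<in>S. A r j = 0")
    case True
    have "card R < card S" using insert by simp
    from insert.IH[OF insert.prems(1) this, of A] obtain x where
      "\<exists>j\<in>S. x j \<noteq> 0" "\<forall>i\<in>R. (\<Sum>j\<in>S. A i j * x j) = 0" by blast
    then show ?thesis using True by (intro exI[of _ x]) auto
  next
    case False
    then obtain p where p: "p \<in> S" "A r p \<noteq> 0" by blast
    define S' where "S' = S - {p}"
    \<comment> \<open>Subtracting the multiple of row \<open>r\<close> that clears column
      \<open>p\<close> gives the reduced coefficients.\<close>
    define A' where "A' i j = A i j - A i p * A r j / A r p" for i j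
    have S': "finite S'" "p \<notin> S'" "S = insert p S'" using insert.prems p by (auto simp: S'_def)
    then have "card R < card S'" using insert by simp
    from insert.IH[OF S'(1) this, of A'] obtain x where
      x: "\<exists>j\<in>S'. x j \<noteq> 0" "\<forall>i\<in>R. (\<Sum>j\<in>S'. A' i j * x j) = 0" by blast
    \<comment> \<open>Equation \<open>r\<close> forces this value on the pivot unknown.\<close>
    define c where "c = - (\<Sum>j\<in>S'. A r j * x j) / A r p"
    define y where "y = x(p := c)"
    have sum_y: "(\<Sum>j\<in>S. A i j * y j) = A i p * c + (\<Sum>j\<in>S'. A i j * x j)" for i
    proof -
      have "(\<Sum>j\<in>S'. A i j * y j) = (\<Sum>j\<in>S'. A i j * x j)"
        using S' by (intro sum.cong) (auto simp: y_def)
      then show ?thesis using S' by (simp add: y_def)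
    qed
    have "(\<Sum>j\<in>S'. A' i j * x j) = (\<Sum>j\<in>S'. A i j * x j) + A i p * c" for i
    proof -
      have "(\<Sum>j\<in>S'. A' i j * x j) = (\<Sum>j\<in>S'. A i j * x j - A i p / A r p * (A r j * x j))"
        by (intro sum.cong) (auto simp: A'_def algebra_simps)
      also have "\<dots> = (\<Sum>j\<in>S'. A i j * x j) - A i p / A r p * (\<Sum>j\<in>S'. A r j * x j)"
        by (simp add: sum_subtractf sum_distrib_left)
      finally show ?thesis by (simp add: c_def)
    qed
    then have "(\<Sum>j\<in>S. A i j * y j) = 0" if "i \<in> R" for i
      using x(2) that by (simp add: sum_y add.commute)
    moreover have "(\<Sum>j\<in>S. A r j * y j) = 0" using p by (simp add: sum_y c_def)
    moreover have "\<exists>j\<in>S. y j \<noteq> 0" using x(1) S' by (auto simp: y_def)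
    ultimately show ?thesis by (intro exI[of _ y]) auto
  qed
qed

text \<open>The augmented homogeneous system has more unknowns than equations. Injectivity keeps the
  spare coordinate of a nontrivial solution away from 0, so it can be normalised to 1.\<close>

lemma square_system_solvable:
  fixes A :: "'a \<Rightarrow> 'a \<Rightarrow> 'c::field" and z :: 'a
  assumes "finite S" "z \<notin> S"
    and inj: "\<And>x. (\<And>i. i \<in> S \<Longrightarrow> (\<Sum>j\<in>S. A i j * x j) = 0) \<Longrightarrow> (\<And>j. j \<in> S \<Longrightarrow> x j = 0)"
  shows "\<exists>x. \<forall>i\<in>S. (\<Sum>j\<in>S. A i j * x j) = b i"
proof -
  \<comment> \<open>The spare index \<open>z\<close> carries the right-hand side as an additional column.\<close>
  have "card S < card (insert z S)" using assms by simp
  from underdetermined_system_nontrivial_solution[OF _ _ this,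
      of "\<lambda>i j. if j = z then - b i else A i j"] assms
  obtain x where nz: "\<exists>j\<in>insert z S. x j \<noteq> 0"
    and eq: "\<And>i. i \<in> S \<Longrightarrow> (\<Sum>j\<in>insert z S. (if j = z then - b i else A i j) * x j) = 0"
    by auto
  have "(\<Sum>j\<in>S. (if j = z then - b i else A i j) * x j) = (\<Sum>j\<in>S. A i j * x j)" for i
    using assms by (intro sum.cong) auto
  with eq assms have eq': "(\<Sum>j\<in>S. A i j * x j) = b i * x z" if "i \<in> S" for i
    using that by simp
  \<comment> \<open>Otherwise \<open>x\<close> would solve the homogeneous system on
    \<open>S\<close> and vanish there as well, contradicting nontriviality.\<close>
  have "x z \<noteq> 0" using nz inj[of x] eq' by force
  then have "\<forall>i\<in>S. (\<Sum>j\<in>S. A i j * (x j / x z)) = b i"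
    using eq' by (simp flip: sum_divide_distrib)
  then show ?thesis by (rule exI[of _ "\<lambda>j. x j / x z"])
qed

section \<open>Quadratic profiles on an interval\<close>

lemma integrable_lebesgue_on_continuous:
  fixes f :: "real \<Rightarrow> real"
  assumes "continuous_on {a..b} f"
  shows "integrable (lebesgue_on {a..b}) f"
  using absolutely_integrable_continuous_real[OF assms]
  by (simp add: integrable_restrict_space set_integrable_def)

lemma lebesgue_on_integral_quadratic:
  fixes a b c t :: real
  assumes "0 \<le> t"
  shows "integral\<^sup>L (lebesgue_on {0..t}) (\<lambda>s. a + b * s + c * s\<^sup>2) = a * t + b * t\<^sup>2 / 2 + c * t ^ 3 / 3"
proof -
  have "((\<lambda>s. a + b * s + c * s\<^sup>2) has_integral
      (a * t + b * t\<^sup>2 / 2 + c * t ^ 3 / 3) - (a * 0 + b * 0\<^sup>2 / 2 + c * 0 ^ 3 / 3)) {0..t}"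
    by (intro fundamental_theorem_of_calculus assms)
      (auto intro!: derivative_eq_intros simp: has_real_derivative_iff_has_vector_derivative[symmetric]
        power2_eq_square)
  then show ?thesis
    by (subst lebesgue_integral_eq_integral)
      (auto intro!: integrable_lebesgue_on_continuous continuous_intros simp: integral_unique)
qed

lemma L2_on_continuous:
  assumes "continuous_on {0..l} f"
  shows "L2_on {0..l} f"
  unfolding L2_on_def
  using integrable_lebesgue_on_continuous[OF assms]
  by (auto intro!: integrable_lebesgue_on_continuous continuous_intros assms)

lemma L2_on_cong:
  assumes "\<And>t. t \<in> {0..l} \<Longrightarrow> f t = g t"
  shows "L2_on {0..l} f \<longleftrightarrow> L2_on {0..l} g"
proof -
  have "f \<in> borel_measurable (lebesgue_on {0..l}) \<longleftrightarrow> g \<in> borel_measurable (lebesgue_on {0..l})"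
    by (intro measurable_cong) (simp add: assms)
  moreover have "integrable (lebesgue_on {0..l}) (\<lambda>t. (f t)\<^sup>2) \<longleftrightarrow> 
      integrable (lebesgue_on {0..l}) (\<lambda>t. (g t)\<^sup>2)"
    by (intro Bochner_Integration.integrable_cong) (simp_all add: assms)
  ultimately show ?thesis by (simp add: L2_on_def)
qed

text \<open>Integrating -1 twice leaves the value and the slope at 0 free. The right side is
  pointwise because a Sobolev function here is its continuous representative; an almost-everywhere
  condition on \<open>h\<close> still determines both integrals.\<close>

lemma H2_second_deriv_minus_one_iff:
  assumes "0 < l"
  shows "(\<exists>h. has_H2_second_deriv l f h \<and> (AE t in lebesgue_on {0..l}. - h t = 1)) \<longleftrightarrow>
    (\<exists>c. \<forall>t\<in>{0..l}. f t = f 0 + c * t - t\<^sup>2 / 2)" (is "?H \<longleftrightarrow> ?Q")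
proof
  assume ?H
  then obtain h g where f: "has_H1_deriv l f g" and g: "has_H1_deriv l g h"
    and h: "AE t in lebesgue_on {0..l}. - h t = 1"
    by (auto simp: has_H2_second_deriv_def)
  have hm: "h \<in> borel_measurable (lebesgue_on {0..l})"
    using g by (simp add: has_H1_deriv_def L2_on_def)
  have g_lin: "g t = g 0 - t" if t: "t \<in> {0..l}" for t
  proof -
    have sub: "{0..t} \<subseteq> {0..l}" using t by auto
    have "AE s in lebesgue_on {0..t}. h s = -1"
      using h sub by (simp add: AE_restrict_space_iff) (auto elim!: eventually_mono)
    moreover have "h \<in> borel_measurable (lebesgue_on {0..t})"
      using hm sub by (rule measurable_restrict_mono)
    ultimately have "integral\<^sup>L (lebesgue_on {0..t}) h = integral\<^sup>L (lebesgue_on {0..t}) (\<lambda>s. -1)"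
      by (intro integral_cong_AE) auto
    also have "\<dots> = - t"
      using lebesgue_on_integral_quadratic[of t "-1" 0 0] t by simp
    finally have "integral\<^sup>L (lebesgue_on {0..t}) h = - t" .
    moreover have "g t = g 0 + integral\<^sup>L (lebesgue_on {0..t}) h"
      using g t unfolding has_H1_deriv_def by blast
    ultimately show ?thesis by simp
  qed
  \<comment> \<open>The zero quadratic term brings \<open>g\<close> into the form of
    \<open>lebesgue_on_integral_quadratic\<close>.\<close>
  have g_eq: "g s = g 0 + (-1) * s + 0 * s\<^sup>2" if "s \<in> {0..l}" for s
    using g_lin[OF that] by simp
  have g_int: "integral\<^sup>L (lebesgue_on {0..t}) g =
      integral\<^sup>L (lebesgue_on {0..t}) (\<lambda>s. g 0 + (-1) * s + 0 * s\<^sup>2)" if "t \<in> {0..l}" for t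
    using that by (intro Bochner_Integration.integral_cong g_eq HOL.refl) auto
  have "f t = f 0 + g 0 * t - t\<^sup>2 / 2" if "t \<in> {0..l}" for t
  proof -
    have "f t = f 0 + integral\<^sup>L (lebesgue_on {0..t}) g"
      using f that unfolding has_H1_deriv_def by blast
    then show ?thesis
      using g_int[OF that] lebesgue_on_integral_quadratic[of t "g 0" "-1" 0] that by simp
  qed
  then show ?Q by blast
next
  assume ?Q
  then obtain c where c: "\<And>t. t \<in> {0..l} \<Longrightarrow> f t = f 0 + c * t - t\<^sup>2 / 2" by blast
  define g where "g t = c + (-1) * t + 0 * t\<^sup>2" for t :: real
  have "L2_on {0..l} (\<lambda>t. f 0 + c * t - t\<^sup>2 / 2)" "L2_on {0..l} g" "L2_on {0..l} (\<lambda>t. -1)"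
    unfolding g_def by (auto intro!: L2_on_continuous continuous_intros)
  moreover have "L2_on {0..l} f \<longleftrightarrow> L2_on {0..l} (\<lambda>t. f 0 + c * t - t\<^sup>2 / 2)"
    using c by (rule L2_on_cong)
  moreover have "g t = g 0 + integral\<^sup>L (lebesgue_on {0..t}) (\<lambda>t. -1)" if "t \<in> {0..l}" for t
    using lebesgue_on_integral_quadratic[of t "-1" 0 0] that by (simp add: g_def)
  moreover have "f t = f 0 + integral\<^sup>L (lebesgue_on {0..t}) g" if "t \<in> {0..l}" for t
    using lebesgue_on_integral_quadratic[of t c "-1" 0] that c[OF that] by (simp add: g_def[abs_def])
  ultimately have "has_H1_deriv l f g" "has_H1_deriv l g (\<lambda>t. -1)"
    unfolding has_H1_deriv_def by blast+
  then have "has_H2_second_deriv l f (\<lambda>t. -1)"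
    by (auto simp: has_H2_second_deriv_def)
  then show ?H by (intro exI[of _ "\<lambda>t. -1"]) simp
qed

lemma vector_derivative_quadratic_within:
  fixes f :: "real \<Rightarrow> real"
  assumes "0 < l" "x \<in> {0..l}" "\<And>t. t \<in> {0..l} \<Longrightarrow> f t = a + c * t - t\<^sup>2 / 2"
  shows "vector_derivative f (at x within {0..l}) = c - x"
proof -
  have "((\<lambda>t. a + c * t - t\<^sup>2 / 2) has_vector_derivative (c - x)) (at x within {0..l})"
    unfolding has_real_derivative_iff_has_vector_derivative[symmetric]
    by (auto intro!: derivative_eq_intros)
  then have "(f has_vector_derivative (c - x)) (at x within {0..l})"
    by (rule has_vector_derivative_transform[rotated 2]) (use assms in auto)
  then show ?thesis
    using assms vector_derivative_within_cbox[of 0 l x f "c - x"] by simp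
qed

section \<open>The discrete problem\<close>

lemma edge_pt_0 [simp]: "edge_pt G e 0 = Vertex (src G e)"
  and edge_pt_elen [simp]: "edge_pt G e (elen G e) =
    (if elen G e = 0 then Vertex (src G e) else Vertex (tgt G e))"
  by (simp_all add: edge_pt_def)

text \<open>Slope at parameter 0 of the parabola with second derivative -1 whose end values are
  those of \<open>f\<close>.\<close>

definition edge_slope :: "('v, 'e) metric_graph \<Rightarrow> ('v \<Rightarrow> real) \<Rightarrow> 'e \<Rightarrow> real" where
  "edge_slope G f e = (f (tgt G e) - f (src G e)) / elen G e + elen G e / 2"

text \<open>The Kirchhoff sum in terms of vertex values: at its target end the parabola has slope
  \<open>edge_slope G f e - elen G e\<close>, and the derivative into the edge is the negative of
  that.\<close>

definition vertex_balance :: "('v, 'e) metric_graph \<Rightarrow> ('v \<Rightarrow> real) \<Rightarrow> 'v \<Rightarrow> real" where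
  "vertex_balance G f w =
    (\<Sum>e \<in> {e \<in> edges G. src G e = w}. edge_slope G f e) +
    (\<Sum>e \<in> {e \<in> edges G. tgt G e = w}. elen G e - edge_slope G f e)"

definition discrete_torsion :: "('v, 'e) metric_graph \<Rightarrow> 'v set \<Rightarrow> ('v \<Rightarrow> real) \<Rightarrow> bool" where
  "discrete_torsion G D f \<longleftrightarrow>
    (\<forall>w\<in>D. f w = 0) \<and> (\<forall>w\<in>verts G - D. vertex_balance G f w = 0)"

text \<open>Separates the weighted graph Laplacian, with weights 1/length, from a source term
  independent of \<open>f\<close>. The source cancels between two solutions and is the right-hand
  side of the linear system for existence.\<close>

lemma vertex_balance_alt:
  "vertex_balance G f w =
    (\<Sum>e \<in> {e \<in> edges G. src G e = w}. (f (tgt G e) - f (src G e)) / elen G e) +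
    (\<Sum>e \<in> {e \<in> edges G. tgt G e = w}. (f (src G e) - f (tgt G e)) / elen G e) +
    ((\<Sum>e \<in> {e \<in> edges G. src G e = w}. elen G e / 2) +
     (\<Sum>e \<in> {e \<in> edges G. tgt G e = w}. elen G e / 2))"
proof -
  have "elen G e - edge_slope G f e = (f (src G e) - f (tgt G e)) / elen G e + elen G e / 2" for e
    by (simp add: edge_slope_def diff_divide_distrib)
  then show ?thesis
    unfolding vertex_balance_def by (simp only:) (simp add: edge_slope_def sum.distrib)
qed

locale dirichlet_graph =
  fixes G :: "('v, 'e) metric_graph" and D :: "'v set"
  assumes graph: "compact_connected_metric_graph G"
    and D_nonempty: "D \<noteq> {}" and D_subset: "D \<subseteq> verts G"
begin

lemma finite_verts: "finite (verts G)"
  and finite_edges: "finite (edges G)"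
  and src_verts: "e \<in> edges G \<Longrightarrow> src G e \<in> verts G"
  and tgt_verts: "e \<in> edges G \<Longrightarrow> tgt G e \<in> verts G"
  and elen_pos: "e \<in> edges G \<Longrightarrow> 0 < elen G e"
  and connected: "connected_space (graph_topology G)"
  using graph by (auto simp: compact_connected_metric_graph_def)

lemma finite_D: "finite D"
  using finite_verts D_subset finite_subset by blast

section \<open>Topology of the glued space and its connectedness\<close>

lemma edge_pt_points: "e \<in> edges G \<Longrightarrow> t \<in> {0..elen G e} \<Longrightarrow> edge_pt G e t \<in> points G"
  by (auto simp: edge_pt_def points_def src_verts tgt_verts)

lemma topspace_graph: "topspace (graph_topology G) = points G"
proof -
  have "{t \<in> {0..elen G e}. edge_pt G e t \<in> points G} = {0..elen G e}" if "e \<in> edges G" for e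
    using edge_pt_points that by auto
  then have "openin (graph_topology G) (points G)"
    by (simp add: openin_graph_topology)
  moreover have "topspace (graph_topology G) \<subseteq> points G"
    using openin_topspace[of "graph_topology G"] by (simp only: openin_graph_topology)
  ultimately show ?thesis
    using openin_subset by blast
qed

text \<open>Turns topological connectedness into a combinatorial statement: a vertex property
  constant along edges would otherwise split the space into two nonempty disjoint open sets.\<close>

lemma edge_invariant_everywhere:
  assumes inv: "\<And>e. e \<in> edges G \<Longrightarrow> P (src G e) \<longleftrightarrow> P (tgt G e)"
    and v: "v \<in> verts G" "P v" and w: "w \<in> verts G"
  shows "P w"
proof (rule ccontr)
  assume "\<not> P w"
  \<comment> \<open>Each open edge goes with its source. As \<open>Q\<close> agrees at both ends,
    the preimage of \<open>U Q\<close> in an edge is the whole interval or empty, hence relatively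
    open.\<close>
  define U where "U Q = Vertex ` {v \<in> verts G. Q v} \<union>
    {Inner e t | e t. e \<in> edges G \<and> 0 < t \<and> t < elen G e \<and> Q (src G e)}" for Q
  have U_open: "openin (graph_topology G) (U Q)"
    if Q: "\<And>e. e \<in> edges G \<Longrightarrow> Q (src G e) \<longleftrightarrow> Q (tgt G e)" for Q
  proof -
    have "{t \<in> {0..elen G e}. edge_pt G e t \<in> U Q} = (if Q (src G e) then {0..elen G e} else {})"
      if "e \<in> edges G" for e
      using that Q[OF that] by (auto simp: U_def edge_pt_def src_verts tgt_verts)
    then show ?thesis
      by (auto simp: openin_graph_topology U_def points_def)
  qed
  have "openin (graph_topology G) (U P)" "openin (graph_topology G) (U (\<lambda>v. \<not> P v))"
    using inv by (auto intro!: U_open)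
  moreover have "topspace (graph_topology G) \<subseteq> U P \<union> U (\<lambda>v. \<not> P v)"
    unfolding topspace_graph by (auto simp: U_def points_def)
  moreover have "U P \<inter> U (\<lambda>v. \<not> P v) = {}"
    by (auto simp: U_def)
  moreover have "Vertex v \<in> U P" "Vertex w \<in> U (\<lambda>v. \<not> P v)"
    using v w \<open>\<not> P w\<close> by (auto simp: U_def)
  ultimately show False
    using connected unfolding connected_space_def by blast
qed

text \<open>Discrete integration by parts: pairs of a vertex and an incident edge end are regrouped
  by edge. Vanishing of \<open>h\<close> on \<open>D\<close> allows summing over all vertices; a
  loop is counted at both ends.\<close>

lemma sum_over_edge_ends:
  fixes a b :: "'e \<Rightarrow> real" and h :: "'v \<Rightarrow> real"
  assumes "\<And>w. w \<in> D \<Longrightarrow> h w = 0"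
  shows "(\<Sum>w \<in> verts G - D. h w *
      ((\<Sum>e \<in> {e \<in> edges G. src G e = w}. a e) + (\<Sum>e \<in> {e \<in> edges G. tgt G e = w}. b e))) =
    (\<Sum>e \<in> edges G. h (src G e) * a e + h (tgt G e) * b e)"
proof -
  have *: "(\<Sum>w \<in> verts G. \<Sum>e \<in> {e \<in> edges G. p e = w}. h w * c e) = (\<Sum>e \<in> edges G. h (p e) * c e)"
    if "\<And>e. e \<in> edges G \<Longrightarrow> p e \<in> verts G" for p and c :: "'e \<Rightarrow> real"
  proof -
    have "(\<Sum>w \<in> verts G. \<Sum>e \<in> {e \<in> edges G. p e = w}. h w * c e) =
        (\<Sum>w \<in> verts G. \<Sum>e \<in> {e \<in> edges G. p e = w}. h (p e) * c e)"
      by (intro sum.cong) auto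
    also have "\<dots> = (\<Sum>e \<in> edges G. h (p e) * c e)"
      using that by (intro sum.group finite_verts finite_edges) auto
    finally show ?thesis .
  qed
  have "(\<Sum>w \<in> verts G - D. h w *
      ((\<Sum>e \<in> {e \<in> edges G. src G e = w}. a e) + (\<Sum>e \<in> {e \<in> edges G. tgt G e = w}. b e))) =
    (\<Sum>w \<in> verts G. h w *
      ((\<Sum>e \<in> {e \<in> edges G. src G e = w}. a e) + (\<Sum>e \<in> {e \<in> edges G. tgt G e = w}. b e)))"
    using assms by (intro sum.mono_neutral_left finite_verts) auto
  also have "\<dots> = (\<Sum>w \<in> verts G. \<Sum>e \<in> {e \<in> edges G. src G e = w}. h w * a e) +
      (\<Sum>w \<in> verts G. \<Sum>e \<in> {e \<in> edges G. tgt G e = w}. h w * b e)"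
    by (simp add: distrib_left sum.distrib sum_distrib_left)
  also have "\<dots> = (\<Sum>e \<in> edges G. h (src G e) * a e + h (tgt G e) * b e)"
    by (simp add: * src_verts tgt_verts sum.distrib)
  finally show ?thesis .
qed

text \<open>Energy argument: testing with \<open>f\<close> itself makes a sum of nonnegative squares
  vanish, so \<open>f\<close> is constant along every edge, and connectedness spreads its zero from
  a Dirichlet vertex.\<close>

lemma dirichlet_laplacian_injective:
  assumes D: "\<And>w. w \<in> D \<Longrightarrow> f w = 0"
    and harm: "\<And>w. w \<in> verts G - D \<Longrightarrow>
      (\<Sum>e \<in> {e \<in> edges G. src G e = w}. (f (tgt G e) - f (src G e)) / elen G e) +
      (\<Sum>e \<in> {e \<in> edges G. tgt G e = w}. (f (src G e) - f (tgt G e)) / elen G e) = 0"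
    and w: "w \<in> verts G"
  shows "f w = 0"
proof -
  have "0 = (\<Sum>e \<in> edges G. f (src G e) * ((f (tgt G e) - f (src G e)) / elen G e) +
      f (tgt G e) * ((f (src G e) - f (tgt G e)) / elen G e))"
    using harm by (subst sum_over_edge_ends[OF D, symmetric]) auto
  also have "\<dots> = (\<Sum>e \<in> edges G. - ((f (tgt G e) - f (src G e))\<^sup>2 / elen G e))"
    by (intro sum.cong) (auto simp: power2_eq_square field_simps dest: elen_pos)
  finally have "(\<Sum>e \<in> edges G. (f (tgt G e) - f (src G e))\<^sup>2 / elen G e) = 0"
    by (simp add: sum_negf)
  then have "(f (tgt G e) - f (src G e))\<^sup>2 / elen G e = 0" if "e \<in> edges G" for e
    using that elen_pos
    by (subst (asm) sum_nonneg_eq_0_iff) (auto simp: finite_edges less_imp_le)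
  then have eq: "f (tgt G e) = f (src G e)" if "e \<in> edges G" for e
    using that elen_pos[OF that] by force
  obtain d where "d \<in> D" using D_nonempty by blast
  then show ?thesis
    using edge_invariant_everywhere[of "\<lambda>v. f v = 0" d w] eq D D_subset w by auto
qed

lemma discrete_torsion_unique:
  assumes f: "discrete_torsion G D f" and g: "discrete_torsion G D g" and w: "w \<in> verts G"
  shows "f w = g w"
proof -
  have "f w - g w = 0"
  proof (rule dirichlet_laplacian_injective[OF _ _ w])
    show "f w - g w = 0" if "w \<in> D" for w
      using f g that by (simp add: discrete_torsion_def)
    fix w assume "w \<in> verts G - D"
    then have "vertex_balance G f w - vertex_balance G g w = 0"
      using f g by (simp add: discrete_torsion_def)
    then show "(\<Sum>e \<in> {e \<in> edges G. src G e = w}.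
        (f (tgt G e) - g (tgt G e) - (f (src G e) - g (src G e))) / elen G e) +
      (\<Sum>e \<in> {e \<in> edges G. tgt G e = w}.
        (f (src G e) - g (src G e) - (f (tgt G e) - g (tgt G e))) / elen G e) = 0"
      unfolding vertex_balance_alt by (simp add: sum_subtractf diff_divide_distrib)
  qed
  then show ?thesis by simp
qed

text \<open>The unknowns are the values off \<open>D\<close> and there is one Kirchhoff equation per
  unknown, so injectivity of the Laplacian yields a solution.\<close>

lemma discrete_torsion_exists: "\<exists>f. discrete_torsion G D f"
proof -
  define S where "S = verts G - D"
  define lap where "lap f w =
      (\<Sum>e \<in> {e \<in> edges G. src G e = w}. (f (tgt G e) - f (src G e)) / elen G e) +
      (\<Sum>e \<in> {e \<in> edges G. tgt G e = w}. (f (src G e) - f (tgt G e)) / elen G e)"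
    for f :: "'v \<Rightarrow> real" and w
  \<comment> \<open>Column \<open>j\<close> is the Laplacian of the indicator of \<open>j\<close>;
    extension by zero through \<open>ext\<close> encodes the Dirichlet condition.\<close>
  define A where "A i j = lap (\<lambda>v. of_bool (v = j)) i" for i j
  define ext where "ext x v = (if v \<in> S then x v else 0)" for x :: "'v \<Rightarrow> real" and v
  have finS: "finite S" using finite_verts by (simp add: S_def)
  have ext_eq: "ext x v = (\<Sum>j\<in>S. of_bool (v = j) * x j)" for x v
  proof -
    have "(\<Sum>j\<in>S. of_bool (v = j) * x j) = (\<Sum>j\<in>S. if v = j then x j else 0)"
      by (intro sum.cong) auto
    also have "\<dots> = ext x v" using finS by (simp add: ext_def)
    finally show ?thesis ..
  qed
  have lap_ext: "(\<Sum>j\<in>S. A i j * x j) = lap (ext x) i" for i x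
  proof -
    \<comment> \<open>The two halves of \<open>lap\<close> differ only by exchanging sources and
      targets, so the endpoint maps are left general.\<close>
    have "(\<Sum>j\<in>S. (\<Sum>e\<in>E. (of_bool (q e = j) - of_bool (p e = j)) / elen G e) * x j) =
        (\<Sum>e\<in>E. (ext x (q e) - ext x (p e)) / elen G e)" for E :: "'e set" and p q :: "'e \<Rightarrow> 'v"
    proof -
      have "(\<Sum>j\<in>S. (\<Sum>e\<in>E. (of_bool (q e = j) - of_bool (p e = j)) / elen G e) * x j) =
          (\<Sum>e\<in>E. \<Sum>j\<in>S. (of_bool (q e = j) - of_bool (p e = j)) / elen G e * x j)"
        unfolding sum_distrib_right by (rule sum.swap)
      also have "\<dots> = (\<Sum>e\<in>E. (ext x (q e) - ext x (p e)) / elen G e)"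
        unfolding ext_eq
        by (simp add: left_diff_distrib diff_divide_distrib sum_subtractf sum_divide_distrib)
      finally show ?thesis .
    qed
    then show ?thesis
      unfolding A_def lap_def by (simp add: distrib_right sum.distrib)
  qed
  \<comment> \<open>A Dirichlet vertex lies outside \<open>S\<close> and serves as the spare
    index.\<close>
  obtain d where d: "d \<in> D" using D_nonempty by blast
  have "\<exists>x. \<forall>i\<in>S. (\<Sum>j\<in>S. A i j * x j) =
      - ((\<Sum>e \<in> {e \<in> edges G. src G e = i}. elen G e / 2) +
         (\<Sum>e \<in> {e \<in> edges G. tgt G e = i}. elen G e / 2))"
  proof (rule square_system_solvable[OF finS])
    show "d \<notin> S" using d by (simp add: S_def)
    fix x j
    assume "\<And>i. i \<in> S \<Longrightarrow> (\<Sum>j\<in>S. A i j * x j) = 0" and j: "j \<in> S"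
    then have "lap (ext x) i = 0" if "i \<in> S" for i using that by (simp add: lap_ext)
    then have "ext x j = 0"
      using j dirichlet_laplacian_injective[of "ext x" j] by (simp add: lap_def S_def ext_def)
    then show "x j = 0" using j by (simp add: ext_def)
  qed
  then obtain x where x: "\<And>i. i \<in> S \<Longrightarrow> lap (ext x) i =
      - ((\<Sum>e \<in> {e \<in> edges G. src G e = i}. elen G e / 2) +
         (\<Sum>e \<in> {e \<in> edges G. tgt G e = i}. elen G e / 2))"
    unfolding lap_ext by blast
  have "discrete_torsion G D (ext x)"
    unfolding discrete_torsion_def
  proof (intro conjI ballI)
    show "ext x w = 0" if "w \<in> D" for w using that by (simp add: ext_def S_def)
    show "vertex_balance G (ext x) w = 0" if "w \<in> verts G - D" for w
    proof -
      have "lap (ext x) w + ((\<Sum>e \<in> {e \<in> edges G. src G e = w}. elen G e / 2) +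
          (\<Sum>e \<in> {e \<in> edges G. tgt G e = w}. elen G e / 2)) = 0"
        using x[of w] that by (simp only: S_def left_minus)
      then show ?thesis unfolding lap_def vertex_balance_alt .
    qed
  qed
  then show ?thesis by blast
qed

section \<open>The torsion function\<close>

text \<open>Reduction to finitely many unknowns: the edge equation leaves a parabola fixed by its
  end values, whose normal derivatives sum to \<open>vertex_balance\<close>. Continuity then follows
  from the edgewise formula.\<close>

lemma torsion_function_iff:
  "is_torsion_function G D u \<longleftrightarrow>
    discrete_torsion G D (\<lambda>v. u (Vertex v)) \<and>
    (\<forall>e\<in>edges G. \<forall>t\<in>{0..elen G e}.
      on_edge G u e t = u (Vertex (src G e)) + edge_slope G (\<lambda>v. u (Vertex v)) e * t - t\<^sup>2 / 2)"
    (is "?T \<longleftrightarrow> ?K \<and> ?E")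
proof -
  have H2_iff: "(\<exists>h. has_H2_second_deriv (elen G e) (on_edge G u e) h \<and>
      (AE t in lebesgue_on {0..elen G e}. - h t = 1)) \<longleftrightarrow>
    (\<forall>t\<in>{0..elen G e}.
      on_edge G u e t = u (Vertex (src G e)) + edge_slope G (\<lambda>v. u (Vertex v)) e * t - t\<^sup>2 / 2)"
    if e: "e \<in> edges G" for e
  proof -
    have l: "0 < elen G e" using elen_pos[OF e] .
    \<comment> \<open>Evaluation at the target end determines the free slope.\<close>
    have "c = edge_slope G (\<lambda>v. u (Vertex v)) e"
      if "\<forall>t\<in>{0..elen G e}. on_edge G u e t = u (Vertex (src G e)) + c * t - t\<^sup>2 / 2" for c
    proof -
      have "u (Vertex (tgt G e)) = u (Vertex (src G e)) + c * elen G e - (elen G e)\<^sup>2 / 2"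
        using that l by (auto dest!: bspec[of _ _ "elen G e"])
      then show ?thesis using l by (simp add: edge_slope_def field_simps power2_eq_square)
    qed
    then show ?thesis
      unfolding H2_second_deriv_minus_one_iff[OF l] by auto
  qed
  have normal: "normal_deriv_sum G u w = vertex_balance G (\<lambda>v. u (Vertex v)) w" if ?E for w
  proof -
    have "vector_derivative (on_edge G u e) (at x within {0..elen G e}) =
        edge_slope G (\<lambda>v. u (Vertex v)) e - x" if "e \<in> edges G" "x \<in> {0..elen G e}" for e x
      using that \<open>?E\<close> elen_pos by (intro vector_derivative_quadratic_within) auto
    then show ?thesis
      unfolding normal_deriv_sum_def vertex_balance_def
      by (intro arg_cong2[of _ _ _ _ "(+)"] sum.cong) (auto simp: elen_pos less_imp_le)
  qed
  \<comment> \<open>In the quotient topology continuity is tested edge by edge, where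
    \<open>u\<close> is a polynomial.\<close>
  have cont: "continuous_map (graph_topology G) euclideanreal u" if ?E
    unfolding continuous_map_def
  proof (intro conjI allI impI)
    fix W :: "real set" assume "openin euclideanreal W"
    then have W: "open W" by simp
    have "openin (top_of_set {0..elen G e})
        {t \<in> {0..elen G e}. edge_pt G e t \<in> {x \<in> topspace (graph_topology G). u x \<in> W}}"
      if e: "e \<in> edges G" for e
    proof -
      define q where "q t = u (Vertex (src G e)) + edge_slope G (\<lambda>v. u (Vertex v)) e * t - t\<^sup>2 / 2" for t
      have "{t \<in> {0..elen G e}. edge_pt G e t \<in> {x \<in> topspace (graph_topology G). u x \<in> W}} =
          {0..elen G e} \<inter> q -` W"
        using \<open>?E\<close> e edge_pt_points[OF e] by (auto simp: topspace_graph q_def)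
      moreover have "continuous_on {0..elen G e} q"
        unfolding q_def by (auto intro!: continuous_intros)
      ultimately show ?thesis
        using W by (simp add: continuous_openin_preimage_gen)
    qed
    then show "openin (graph_topology G) {x \<in> topspace (graph_topology G). u x \<in> W}"
      by (auto simp: openin_graph_topology topspace_graph)
  qed auto
  show ?thesis
    unfolding is_torsion_function_def discrete_torsion_def
    using H2_iff normal cont by auto
qed

lemma torsion_function_exists:
  "\<exists>u. u \<in> extensional (points G) \<and> is_torsion_function G D u"
proof -
  obtain f where f: "discrete_torsion G D f" using discrete_torsion_exists by blast
  define u where "u = restrict (\<lambda>x. case x of Vertex v \<Rightarrow> f v
    | Inner e t \<Rightarrow> f (src G e) + edge_slope G f e * t - t\<^sup>2 / 2) (points G)"
  have uV: "u (Vertex v) = f v" if "v \<in> verts G" for v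
    using that by (simp add: u_def points_def)
  have slope: "edge_slope G (\<lambda>v. u (Vertex v)) e = edge_slope G f e" if "e \<in> edges G" for e
    using that by (simp add: edge_slope_def uV src_verts tgt_verts)
  have "vertex_balance G (\<lambda>v. u (Vertex v)) w = vertex_balance G f w" for w
    unfolding vertex_balance_def by (intro arg_cong2[of _ _ _ _ "(+)"] sum.cong) (auto simp: slope)
  then have "discrete_torsion G D (\<lambda>v. u (Vertex v))"
    using f D_subset by (auto simp: discrete_torsion_def uV subset_iff)
  moreover have "on_edge G u e t = u (Vertex (src G e)) + edge_slope G (\<lambda>v. u (Vertex v)) e * t - t\<^sup>2 / 2"
    if e: "e \<in> edges G" and t: "t \<in> {0..elen G e}" for e t
  proof -
    have l: "0 < elen G e" using elen_pos[OF e] .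
    consider "t = 0" | "t = elen G e" | "0 < t" "t < elen G e" using t by fastforce
    then show ?thesis
    proof cases
      case 1 then show ?thesis by simp
    next
      \<comment> \<open>Here \<open>u\<close> takes the prescribed value at the target vertex, and
        \<open>edge_slope\<close> is exactly the slope with which the parabola reaches it.\<close>
      case 2
      then show ?thesis using l e
        by (simp add: slope uV src_verts tgt_verts)
          (simp add: edge_slope_def field_simps power2_eq_square)
    next
      case 3
      then have "edge_pt G e t = Inner e t" "Inner e t \<in> points G"
        using e by (auto simp: edge_pt_def points_def)
      then show ?thesis using e by (simp add: slope uV src_verts) (simp add: u_def)
    qed
  qed
  ultimately have "is_torsion_function G D u"
    unfolding torsion_function_iff by blast
  moreover have "u \<in> extensional (points G)" by (simp add: u_def)
  ultimately show ?thesis by blast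
qed

lemma torsion_function_unique:
  assumes u: "u \<in> extensional (points G)" "is_torsion_function G D u"
    and v: "v \<in> extensional (points G)" "is_torsion_function G D v"
  shows "u = v"
proof (rule extensionalityI[OF u(1) v(1)])
  fix x assume x: "x \<in> points G"
  have eq: "u (Vertex w) = v (Vertex w)" if "w \<in> verts G" for w
    using u v discrete_torsion_unique[OF _ _ that] by (auto simp: torsion_function_iff)
  from x consider w where "x = Vertex w" "w \<in> verts G"
    | e t where "x = Inner e t" "e \<in> edges G" "0 < t" "t < elen G e"
    by (auto simp: points_def)
  then show "u x = v x"
  proof cases
    case 1 then show ?thesis by (simp add: eq)
  next
    case 2
    then have "x = edge_pt G e t" by (simp add: edge_pt_def)
    then show ?thesis using u v 2
      by (simp add: torsion_function_iff edge_slope_def eq src_verts tgt_verts)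
  qed
qed

lemma is_torsion_function_torsion_function: "is_torsion_function G D (torsion_function G D)"
proof -
  have "\<exists>!u. u \<in> extensional (points G) \<and> is_torsion_function G D u"
    using torsion_function_exists torsion_function_unique by (intro ex_ex1I) auto
  from theI'[OF this] show ?thesis by (simp add: torsion_function_def)
qed

section \<open>Variational lower bound for the torsional rigidity\<close>

text \<open>
  The summand is the maximum of \<open>\<integral> 2 \<phi> - \<phi>'\<^sup>2\<close> over all \<open>\<phi>\<close> on the edge
  with the boundary values of \<open>g\<close>.
\<close>

lemma torsional_rigidity_ge:
  assumes g: "\<And>w. w \<in> D \<Longrightarrow> g w = 0"
  shows "torsional_rigidity G D \<ge> (\<Sum>e\<in>edges G. elen G e * (g (src G e) + g (tgt G e)) +
    elen G e ^ 3 / 12 - (g (src G e) - g (tgt G e))\<^sup>2 / elen G e)"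
proof -
  define u where "u = torsion_function G D"
  define f where "f v = u (Vertex v)" for v
  have f: "discrete_torsion G D f" and u: "\<And>e t. e \<in> edges G \<Longrightarrow> t \<in> {0..elen G e} \<Longrightarrow>
      on_edge G u e t = f (src G e) + edge_slope G f e * t + (- 1 / 2) * t\<^sup>2"
    using is_torsion_function_torsion_function
    by (simp_all add: torsion_function_iff u_def f_def[abs_def])
  \<comment> \<open>\<open>q e\<close> is the integral of the torsion function over
    \<open>e\<close>, and \<open>j e\<close> is the summand of the claim.\<close>
  define q where "q e = elen G e / 2 * (f (src G e) + f (tgt G e)) + elen G e ^ 3 / 12" for e
  define j where "j e = elen G e * (g (src G e) + g (tgt G e)) +
    elen G e ^ 3 / 12 - (g (src G e) - g (tgt G e))\<^sup>2 / elen G e" for e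
  \<comment> \<open>The contribution of \<open>e\<close> when the Kirchhoff conditions are tested
    against \<open>h\<close>.\<close>
  define r where "r h e = elen G e / 2 * (h (src G e) + h (tgt G e)) -
      (h (src G e) - h (tgt G e)) * (f (src G e) - f (tgt G e)) / elen G e" for h e
  \<comment> \<open>Weak formulation: multiplying each Kirchhoff condition by \<open>h\<close> and
    regrouping by edges.\<close>
  have weak: "(\<Sum>e\<in>edges G. r h e) = 0" if h: "\<And>w. w \<in> D \<Longrightarrow> h w = 0" for h
  proof -
    have "(\<Sum>w \<in> verts G - D. h w * vertex_balance G f w) = 0"
      using f by (simp add: discrete_torsion_def)
    then have "(\<Sum>e \<in> edges G. h (src G e) * edge_slope G f e +
        h (tgt G e) * (elen G e - edge_slope G f e)) = 0"
      unfolding vertex_balance_def by (subst (asm) sum_over_edge_ends[OF h]) auto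
    moreover have "h (src G e) * edge_slope G f e + h (tgt G e) * (elen G e - edge_slope G f e) = r h e"
      if "e \<in> edges G" for e
      using elen_pos[OF that] by (simp add: edge_slope_def r_def field_simps)
    ultimately show ?thesis by simp
  qed
  have edge: "integral\<^sup>L (lebesgue_on {0..elen G e}) (on_edge G u e) = q e" if e: "e \<in> edges G" for e
  proof -
    have l: "0 < elen G e" using elen_pos[OF e] .
    have "integral\<^sup>L (lebesgue_on {0..elen G e}) (on_edge G u e) =
        integral\<^sup>L (lebesgue_on {0..elen G e})
          (\<lambda>t. f (src G e) + edge_slope G f e * t + (- 1 / 2) * t\<^sup>2)"
      using u[OF e] by (intro Bochner_Integration.integral_cong) auto
    also have "\<dots> = f (src G e) * elen G e + edge_slope G f e * (elen G e)\<^sup>2 / 2 +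
        (- 1 / 2) * elen G e ^ 3 / 3"
      using l by (intro lebesgue_on_integral_quadratic) simp
    also have "\<dots> = q e"
      using l by (simp add: q_def edge_slope_def field_simps power2_eq_square power3_eq_cube)
    finally show ?thesis .
  qed
  have f0: "f w = 0" if "w \<in> D" for w using f that by (simp add: discrete_torsion_def)
  \<comment> \<open>With \<open>x\<close>, \<open>y\<close> the drops of \<open>f\<close>,
    \<open>g\<close> along the edge, this combination is the complete square
    \<open>(x - y)\<^sup>2 / elen G e\<close>. In the sum over all edges both \<open>r\<close> terms
    vanish by \<open>weak\<close>, leaving the comparison of \<open>q\<close> with
    \<open>j\<close>.\<close>
  have pointwise: "0 \<le> q e - j e - r f e + 2 * r g e" if e: "e \<in> edges G" for e
  proof -
    define x y where "x = f (src G e) - f (tgt G e)" and "y = g (src G e) - g (tgt G e)"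
    have "(x - y)\<^sup>2 = x * x - 2 * (y * x) + y\<^sup>2"
      by (simp add: power2_eq_square algebra_simps)
    then have "(x - y)\<^sup>2 / elen G e = x * x / elen G e - 2 * (y * x / elen G e) + y\<^sup>2 / elen G e"
      by (simp add: add_divide_distrib diff_divide_distrib)
    also have "\<dots> = q e - j e - r f e + 2 * r g e"
      unfolding q_def j_def r_def x_def[symmetric] y_def[symmetric] by (simp add: algebra_simps)
    finally show ?thesis using elen_pos[OF e] by (metis divide_nonneg_pos zero_le_power2)
  qed
  have "0 \<le> (\<Sum>e\<in>edges G. q e - j e - r f e + 2 * r g e)"
    using pointwise by (rule sum_nonneg)
  also have "\<dots> = (\<Sum>e\<in>edges G. q e) - (\<Sum>e\<in>edges G. j e) -
      (\<Sum>e\<in>edges G. r f e) + 2 * (\<Sum>e\<in>edges G. r g e)"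
    by (simp only: sum.distrib sum_subtractf sum_distrib_left)
  also have "(\<Sum>e\<in>edges G. r f e) = 0" using f0 by (rule weak)
  also have "(\<Sum>e\<in>edges G. r g e) = 0" using g by (rule weak)
  also have "(\<Sum>e\<in>edges G. q e) = torsional_rigidity G D"
    unfolding torsional_rigidity_def u_def[symmetric] by (intro sum.cong HOL.refl) (simp add: edge)
  finally have "(\<Sum>e\<in>edges G. j e) \<le> torsional_rigidity G D" by simp
  then show ?thesis unfolding j_def .
qed

section \<open>Distance to the Dirichlet vertices\<close>

definition dirichlet_dist :: "('v, 'e) point \<Rightarrow> real" where
  "dirichlet_dist x = (MIN w \<in> D. graph_dist G x (Vertex w))"

lemma graph_walk_nonneg: "graph_walk G x r y \<Longrightarrow> 0 \<le> r"
  by (induction rule: graph_walk.induct) auto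

lemma bdd_below_walks: "bdd_below {r. graph_walk G x r y}"
  by (rule bdd_belowI[of _ 0]) (auto dest: graph_walk_nonneg)

lemma graph_dist_le: "graph_walk G x r y \<Longrightarrow> graph_dist G x y \<le> r"
  unfolding graph_dist_def by (rule cInf_lower) (auto intro: bdd_below_walks)

text \<open>A walk from one point of the edge becomes a walk from the other by prepending the
  segment between them.\<close>

lemma graph_dist_edge_lipschitz:
  assumes e: "e \<in> edges G" and s: "s \<in> {0..elen G e}" and t: "t \<in> {0..elen G e}"
  shows "graph_dist G (edge_pt G e s) y \<le> \<bar>s - t\<bar> + graph_dist G (edge_pt G e t) y"
proof (cases "\<exists>r. graph_walk G (edge_pt G e t) r y")
  case True
  have "graph_dist G (edge_pt G e s) y - \<bar>s - t\<bar> \<le> graph_dist G (edge_pt G e t) y"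
    unfolding graph_dist_def[of G "edge_pt G e t"]
  proof (rule cInf_greatest)
    fix r assume "r \<in> {r. graph_walk G (edge_pt G e t) r y}"
    then show "graph_dist G (edge_pt G e s) y - \<bar>s - t\<bar> \<le> r"
      using graph_dist_le[OF graph_walk.step[OF e s t]] by force
  qed (use True in auto)
  then show ?thesis by simp
next
  \<comment> \<open>Neither point then has a walk to \<open>y\<close>, so both distances are the
    same default value \<open>Inf {}\<close>.\<close>
  case False
  then have "\<not> graph_walk G (edge_pt G e s) r y" for r
    using graph_walk.step[OF e t s] by blast
  with False show ?thesis by (simp add: graph_dist_def)
qed

lemma dirichlet_dist_edge_lipschitz:
  assumes "e \<in> edges G" "s \<in> {0..elen G e}" "t \<in> {0..elen G e}"
  shows "dirichlet_dist (edge_pt G e s) \<le> \<bar>s - t\<bar> + dirichlet_dist (edge_pt G e t)"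
proof -
  have "dirichlet_dist (edge_pt G e t) \<in> (\<lambda>w. graph_dist G (edge_pt G e t) (Vertex w)) ` D"
    unfolding dirichlet_dist_def using finite_D D_nonempty by (intro Min_in) auto
  then obtain w where w: "w \<in> D"
    "dirichlet_dist (edge_pt G e t) = graph_dist G (edge_pt G e t) (Vertex w)" by auto
  have "dirichlet_dist (edge_pt G e s) \<le> graph_dist G (edge_pt G e s) (Vertex w)"
    unfolding dirichlet_dist_def using finite_D w by (intro Min_le) auto
  then show ?thesis using graph_dist_edge_lipschitz[OF assms, of "Vertex w"] w by simp
qed

lemma dirichlet_dist_le_0: "w \<in> D \<Longrightarrow> dirichlet_dist (Vertex w) \<le> 0"
proof -
  assume w: "w \<in> D"
  then have "graph_walk G (Vertex w) 0 (Vertex w)"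
    using D_subset by (intro graph_walk.refl) (auto simp: points_def)
  then have "graph_dist G (Vertex w) (Vertex w) \<le> 0" by (rule graph_dist_le)
  moreover have "dirichlet_dist (Vertex w) \<le> graph_dist G (Vertex w) (Vertex w)"
    unfolding dirichlet_dist_def using finite_D w by (intro Min_le) auto
  ultimately show ?thesis by simp
qed

text \<open>A point of an edge is within half the edge length of one of its ends.\<close>

lemma inradius_le:
  assumes K: "\<And>v. v \<in> verts G \<Longrightarrow> dirichlet_dist (Vertex v) \<le> K"
    and m: "0 \<le> m" "\<And>e. e \<in> edges G \<Longrightarrow> elen G e \<le> m"
  shows "inradius G D \<le> K + m / 2"
proof -
  have "dirichlet_dist x \<le> K + m / 2" if "x \<in> points G" for x
  proof -
    from that consider v where "x = Vertex v" "v \<in> verts G"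
      | e t where "x = Inner e t" "e \<in> edges G" "0 < t" "t < elen G e"
      by (auto simp: points_def)
    then show ?thesis
    proof cases
      case 1 then show ?thesis using K[of v] m by simp
    next
      case 2
      then have x: "edge_pt G e t = x" by (simp add: edge_pt_def)
      have "dirichlet_dist x \<le> t + dirichlet_dist (Vertex (src G e))"
        using dirichlet_dist_edge_lipschitz[of e t 0] 2 x by simp
      moreover have "dirichlet_dist x \<le> (elen G e - t) + dirichlet_dist (Vertex (tgt G e))"
        using dirichlet_dist_edge_lipschitz[of e t "elen G e"] 2 x by simp
      \<comment> \<open>Averaging the two bounds eliminates \<open>t\<close>.\<close>
      ultimately show ?thesis
        using K[OF src_verts[OF 2(2)]] K[OF tgt_verts[OF 2(2)]] m(2)[OF 2(2)] by simp
    qed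
  qed
  moreover have "points G \<noteq> {}" using D_nonempty D_subset by (auto simp: points_def)
  ultimately show ?thesis
    unfolding inradius_def dirichlet_dist_def[symmetric] by (intro cSUP_least) auto
qed

text \<open>Pigeonhole: the N + 1 open intervals are disjoint, and only the N vertices outside
  \<open>D\<close> can have their distance in one of them.\<close>

lemma vertex_free_gap:
  assumes "0 < L"
  shows "\<exists>k \<le> card (verts G - D). \<forall>v\<in>verts G.
    dirichlet_dist (Vertex v) \<le> real k * L \<or> (real k + 1) * L \<le> dirichlet_dist (Vertex v)"
proof (rule ccontr)
  let ?N = "card (verts G - D)"
  assume "\<not> ?thesis"
  then have "\<exists>v. v \<in> verts G \<and> real k * L < dirichlet_dist (Vertex v) \<and>
      dirichlet_dist (Vertex v) < (real k + 1) * L" if "k \<le> ?N" for k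
    using that unfolding not_ex not_le by (meson not_le)
  then have "\<forall>k. \<exists>v. k \<le> ?N \<longrightarrow> v \<in> verts G \<and> real k * L < dirichlet_dist (Vertex v) \<and>
      dirichlet_dist (Vertex v) < (real k + 1) * L"
    by blast
  from choice[OF this] obtain v where "\<forall>k. k \<le> ?N \<longrightarrow> v k \<in> verts G \<and>
      real k * L < dirichlet_dist (Vertex (v k)) \<and> dirichlet_dist (Vertex (v k)) < (real k + 1) * L" ..
  then have v: "\<And>k. k \<le> ?N \<Longrightarrow> v k \<in> verts G \<and>
      real k * L < dirichlet_dist (Vertex (v k)) \<and> dirichlet_dist (Vertex (v k)) < (real k + 1) * L"
    by simp
  \<comment> \<open>The intervals start at \<open>real k * L \<ge> 0\<close>, while Dirichlet
    vertices have distance at most 0.\<close>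
  have "v k \<notin> D" if "k \<le> ?N" for k
  proof
    assume "v k \<in> D"
    then have "real k * L < 0" using v[OF that] dirichlet_dist_le_0[of "v k"] by linarith
    then show False using assms by (simp add: mult_less_0_iff)
  qed
  then have "v ` {..?N} \<subseteq> verts G - D" using v by auto
  moreover have "inj_on v {..?N}"
  proof (rule inj_onI)
    fix i j assume ij: "i \<in> {..?N}" "j \<in> {..?N}" "v i = v j"
    \<comment> \<open>One distance lying in both interval \<open>i\<close> and interval
      \<open>j\<close> forces the indices to differ by less than 1.\<close>
    then have "real i * L < (real j + 1) * L" "real j * L < (real i + 1) * L"
      using v[of i] v[of j] unfolding atMost_iff by (metis less_trans)+
    then have "real i < real j + 1" "real j < real i + 1" using assms by simp_all
    then show "i = j" by linarith
  qed
  ultimately have "card {..?N} \<le> ?N"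
    using finite_verts by (intro card_inj_on_le) auto
  then show False by simp
qed

section \<open>Test functions and the final estimate\<close>

lemma torsional_rigidity_ge_edge:
  assumes "e \<in> edges G"
  shows "elen G e ^ 3 / 12 \<le> torsional_rigidity G D"
proof -
  have "elen G e ^ 3 / 12 \<le> (\<Sum>e\<in>edges G. elen G e ^ 3 / 12)"
    using assms finite_edges elen_pos
    by (intro member_le_sum[of e "edges G" "\<lambda>e. elen G e ^ 3 / 12"]) (auto simp: less_imp_le)
  \<comment> \<open>The zero test function leaves only the cubic terms.\<close>
  also have "\<dots> \<le> torsional_rigidity G D"
    using torsional_rigidity_ge[of "\<lambda>_. 0"] by simp
  finally show ?thesis .
qed

lemma torsional_rigidity_nonneg: "0 \<le> torsional_rigidity G D"
proof -
  have "0 \<le> (\<Sum>e\<in>edges G. elen G e ^ 3 / 12)"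
    using elen_pos by (intro sum_nonneg) (auto simp: less_imp_le)
  also have "\<dots> \<le> torsional_rigidity G D"
    using torsional_rigidity_ge[of "\<lambda>_. 0"] by simp
  finally show ?thesis .
qed

text \<open>The right side grows with \<open>l\<close>, and at \<open>l = L\<close> it equals (1/2 +
  1/12 - 1/4) \<open>L ^ 3\<close>.\<close>

lemma crossing_edge_bound:
  fixes l L :: real
  assumes "0 < L" "L \<le> l"
  shows "L ^ 3 / 3 \<le> l * (L\<^sup>2 / 2) + l ^ 3 / 12 - (L\<^sup>2 / 2)\<^sup>2 / l"
proof -
  have "L * (L\<^sup>2 / 2) \<le> l * (L\<^sup>2 / 2)" using assms by (intro mult_right_mono) auto
  moreover have "L ^ 3 \<le> l ^ 3" using assms by (intro power_mono) auto
  moreover have "(L\<^sup>2 / 2)\<^sup>2 / l \<le> (L\<^sup>2 / 2)\<^sup>2 / L"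
    using assms by (intro divide_left_mono) auto
  moreover have "(L\<^sup>2 / 2)\<^sup>2 / L = L ^ 3 / 4" "L * (L\<^sup>2 / 2) = L ^ 3 / 2"
    using assms by (simp_all add: power2_eq_square power3_eq_cube field_simps)
  ultimately show ?thesis by linarith
qed

text \<open>A step function across the gap loses energy only on crossing edges, and by the Lipschitz
  bound these are at least as long as the gap is wide.\<close>

lemma torsional_rigidity_ge_gap:
  assumes L: "0 < L" and c: "0 \<le> c"
    and gap: "\<And>v. v \<in> verts G \<Longrightarrow>
      dirichlet_dist (Vertex v) \<le> c \<or> c + L \<le> dirichlet_dist (Vertex v)"
    and v: "v \<in> verts G" "c < dirichlet_dist (Vertex v)"
  shows "L ^ 3 / 3 \<le> torsional_rigidity G D"
proof -
  let ?P = "\<lambda>v. dirichlet_dist (Vertex v) \<le> c"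
  \<comment> \<open>The height \<open>L\<^sup>2 / 2\<close> is the \<open>h\<close> that maximises
    \<open>L * h - h\<^sup>2 / L\<close>, the gain minus the cost on a crossing edge of length
    \<open>L\<close>.\<close>
  define g where "g v = (if ?P v then 0 else L\<^sup>2 / 2)" for v
  define j where "j e = elen G e * (g (src G e) + g (tgt G e)) +
    elen G e ^ 3 / 12 - (g (src G e) - g (tgt G e))\<^sup>2 / elen G e" for e
  have cross: "L ^ 3 / 3 \<le> j e" if e: "e \<in> edges G" and ne: "?P (src G e) \<noteq> ?P (tgt G e)" for e
  proof -
    have l: "0 < elen G e" using elen_pos[OF e] .
    have "dirichlet_dist (Vertex (src G e)) \<le> elen G e + dirichlet_dist (Vertex (tgt G e))"
      "dirichlet_dist (Vertex (tgt G e)) \<le> elen G e + dirichlet_dist (Vertex (src G e))"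
      using dirichlet_dist_edge_lipschitz[OF e, of 0 "elen G e"]
        dirichlet_dist_edge_lipschitz[OF e, of "elen G e" 0] l by simp_all
    then have "L \<le> elen G e"
      using ne gap[OF src_verts[OF e]] gap[OF tgt_verts[OF e]] by auto
    from crossing_edge_bound[OF L this] ne show ?thesis
      by (auto simp: j_def g_def)
  qed
  have nonneg: "0 \<le> j e" if e: "e \<in> edges G" for e
  proof (cases "?P (src G e) = ?P (tgt G e)")
    case True
    then have "g (src G e) = g (tgt G e)" "0 \<le> g (tgt G e)" by (auto simp: g_def)
    then show ?thesis using elen_pos[OF e] by (simp add: j_def)
  next
    case False
    with cross[OF e] have "L ^ 3 / 3 \<le> j e" by blast
    moreover have "0 \<le> L ^ 3 / 3" using L by simp
    ultimately show ?thesis by linarith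
  qed
  obtain d where d: "d \<in> D" using D_nonempty by blast
  then have "?P d" using dirichlet_dist_le_0[of d] c by simp
  \<comment> \<open>Without a crossing edge, lying below the gap would be constant along edges and
    pass from \<open>d\<close> to \<open>v\<close>.\<close>
  then obtain e where e: "e \<in> edges G" "?P (src G e) \<noteq> ?P (tgt G e)"
    using edge_invariant_everywhere[of ?P d v] d D_subset v by force
  have "L ^ 3 / 3 \<le> j e" using cross e by blast
  also have "\<dots> \<le> (\<Sum>e\<in>edges G. j e)"
    using e nonneg finite_edges by (intro member_le_sum) auto
  also have "\<dots> \<le> torsional_rigidity G D"
    unfolding j_def
  proof (rule torsional_rigidity_ge)
    show "g w = 0" if "w \<in> D" for w
      using dirichlet_dist_le_0[OF that] c by (simp add: g_def)
  qed
  finally show ?thesis .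
qed

lemma torsional_rigidity_ge_inradius:
  "inradius G D ^ 3 / (3 * (real (card (verts G - D)) + 1) ^ 3) \<le> torsional_rigidity G D"
proof -
  define N where "N = card (verts G - D)"
  define L where "L = inradius G D / (real N + 1)"
  have inr: "inradius G D = (real N + 1) * L" by (simp add: L_def)
  have "L ^ 3 / 3 \<le> torsional_rigidity G D"
  proof (cases "0 < L")
    \<comment> \<open>The cube has the sign of \<open>L\<close>, so nonnegativity of the rigidity
      suffices.\<close>
    case False
    then have "L ^ 3 / 3 \<le> 0" by (simp add: power3_eq_cube mult_le_0_iff zero_le_mult_iff)
    then show ?thesis using torsional_rigidity_nonneg by linarith
  next
    case True
    from vertex_free_gap[OF True] obtain k where k: "k \<le> N" and
      gap: "\<And>v. v \<in> verts G \<Longrightarrow> dirichlet_dist (Vertex v) \<le> real k * L \<or>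
        real k * L + L \<le> dirichlet_dist (Vertex v)"
      by (auto simp: N_def algebra_simps)
    show ?thesis
    proof (cases "\<exists>v\<in>verts G. real k * L < dirichlet_dist (Vertex v)")
      case above: True
      then show ?thesis using torsional_rigidity_ge_gap[OF True _ gap] True by auto
    next
      case False
      \<comment> \<open>Inserting 0 keeps the maximum well defined for a graph without edges and
        makes \<open>m\<close> nonnegative.\<close>
      define m where "m = Max (insert 0 (elen G ` edges G))"
      have fin: "finite (insert 0 (elen G ` edges G))" using finite_edges by simp
      have "inradius G D \<le> real k * L + m / 2"
        using False fin by (intro inradius_le) (auto simp: m_def not_less)
      moreover have "real k * L \<le> real N * L" using k True by simp
      \<comment> \<open>The inradius is \<open>(real N + 1) * L\<close>, of which the vertices
        account for at most \<open>real N * L\<close>; half of a longest edge must supply the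
        remaining \<open>L\<close>.\<close>
      ultimately have m: "2 * L \<le> m" using inr by (simp add: algebra_simps)
      moreover have "m \<in> insert 0 (elen G ` edges G)" unfolding m_def using fin by (rule Max_in) simp
      ultimately obtain e where e: "e \<in> edges G" "2 * L \<le> elen G e" using True by auto
      \<comment> \<open>The zero test function gives \<open>(2 * L) ^ 3 / 12\<close>, which is twice
        the required \<open>L ^ 3 / 3\<close>.\<close>
      have "(2 * L) ^ 3 \<le> elen G e ^ 3" using e True by (intro power_mono) auto
      moreover have "(2 * L) ^ 3 = 8 * L ^ 3" by (simp add: power_mult_distrib)
      moreover have "0 \<le> L ^ 3" using True by simp
      ultimately show ?thesis using torsional_rigidity_ge_edge[OF e(1)] by linarith
    qed
  qed
  then show ?thesis by (simp add: L_def N_def power_divide mult.commute)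
qed

end

theorem proposition4p4:
  fixes G :: "('v, 'e) metric_graph" and D :: "'v set"
  assumes "compact_connected_metric_graph G"
    and "D \<noteq> {}" and "D \<subseteq> verts G"
  shows "torsional_rigidity G D \<ge> inradius G D ^ 3 / (3 * (real (card (verts G - D)) + 1) ^ 3)"
proof -
  interpret dirichlet_graph G D using assms by unfold_locales
  show ?thesis by (rule torsional_rigidity_ge_inradius)
qed

end
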